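(* Let $k$ be a positive integer and let $D$ be an oriented graph. If $D$ is both $k$-anti-transitive and $(k-4)$-free, then $D$ has a Seymour vertex, i.e. there is a vertex $v \in V(D)$ with $d^+(v) \leq d^{++}(v)$.
   Context: A digraph $D=(V,E)$ has a non-empty vertex set $V=V(D)$ and arc set $E=E(D)\subseteq V\times V$. An oriented graph is a finite digraph with no loops ($(u,u)\notin E$) and with at most one arc between any two vertices (so $(u,v)$ and $(v,u)$ are never both in $E$). Directed paths and directed cycles have pairwise distinct vertices (apart from the coinciding endpoints of a cycle); the length of a directed path or cycle is its number of arcs. The distance $\mathrm{dist}(v,u)$ is the length of a shortest directed path from $v$ to $u$. For a vertex $v$, $N^+(v)=\{u\in V : \mathrm{dist}(v,u)=1\}$, $d^+(v)=|N^+(v)|$, $N^{++}(v)=\{w\in V:\mathrm{dist}(v,w)=2\}$ and $d^{++}(v)=|N^{++}(v)|$. A Seymour vertex is a vertex $v$ with $d^+(v)\leq d^{++}(v)$. A digraph $D$ is $k$-anti-transitive if for every pair of vertices $u,v\in V(D)$, the existence of a directed path of length $k$ from $u$ to $v$ implies $(u,v)\notin E(D)$. A digraph is $m$-free if it has no directed cycle of length at most $m$ (for an oriented graph this is a vacuous condition when $m\leq 2$). *)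

theory Defs
  imports "Graph_Theory.Pair_Digraph" "HOL-Library.Extended_Nat"
begin

text \<open>
  Digraphs without parallel arcs are \<open>pair_pre_digraph\<close> records, with vertex set \<open>pverts\<close> and
  arc set \<open>parcs\<close>, a set of pairs.  Finiteness and looplessness come from \<open>pair_digraph\<close>.
\<close>

locale oriented_graph = pair_digraph D for D :: "'a pair_pre_digraph" +
  assumes verts_nonempty: "pverts D \<noteq> {}"
    and no_opposite_arcs: "(u, v) \<in> parcs D \<Longrightarrow> (v, u) \<notin> parcs D"

context pair_pre_digraph
begin

text \<open>
  The library's \<open>apath u p v\<close> and \<open>cycle p\<close> represent directed paths and cycles by their lists
  of arcs, so \<open>length p\<close> is the number of arcs.  The distance is \<open>\<infinity>\<close> if there is no path.
\<close>

definition vdist :: "'a \<Rightarrow> 'a \<Rightarrow> enat" where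
  "vdist v u = (INF p\<in>{p. apath v p u}. enat (length p))"

definition out_nbrs :: "'a \<Rightarrow> 'a set" where
  "out_nbrs v = {u \<in> pverts G. vdist v u = 1}"

definition second_out_nbrs :: "'a \<Rightarrow> 'a set" where
  "second_out_nbrs v = {w \<in> pverts G. vdist v w = 2}"

definition seymour_vertex :: "'a \<Rightarrow> bool" where
  "seymour_vertex v \<longleftrightarrow> v \<in> pverts G \<and> card (out_nbrs v) \<le> card (second_out_nbrs v)"

definition anti_transitive :: "nat \<Rightarrow> bool" where
  "anti_transitive k \<longleftrightarrow>
    (\<forall>u\<in>pverts G. \<forall>v\<in>pverts G. (\<exists>p. apath u p v \<and> length p = k) \<longrightarrow> (u, v) \<notin> parcs G)"

text \<open>
  The bound is an integer, so that \<open>m = k - 4\<close> is not truncated for \<open>k < 4\<close>; since a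
  \<open>cycle\<close> is a non-empty list of arcs, the condition is vacuous for \<open>m \<le> 0\<close>.
\<close>

definition cycle_free_upto :: "int \<Rightarrow> bool" where
  "cycle_free_upto m \<longleftrightarrow> \<not> (\<exists>p. cycle p \<and> int (length p) \<le> m)"

end

end

theory Submission
  imports Defs
begin

text \<open>
  Suppose no vertex is a Seymour vertex, let \<open>v\<close> have minimum out-degree, and let \<open>g = max 3 (k - 3)\<close>,
  a lower bound for the length of a directed cycle.  Every \<open>x \<in> N(v)\<close> has an out-neighbour in
  \<open>N(v)\<close>, for otherwise \<open>N(x) \<subseteq> N\<^sup>+\<^sup>+(v)\<close> would make \<open>v\<close> a Seymour vertex; and every path inside \<open>N(v)\<close>
  has fewer than \<open>k \<le> g + 3\<close> vertices, as \<open>v\<close> followed by a path on \<open>k\<close> vertices of \<open>N(v)\<close>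
  contradicts anti-transitivity.  So a path that cannot be extended inside \<open>N(v)\<close> has between \<open>g\<close>
  and \<open>g + 2\<close> vertices, and its end sends all its arcs in \<open>N(v)\<close> to the first three of them.

  If \<open>k < 2g\<close>, then some \<open>x \<in> N(v)\<close> has exactly one out-neighbour \<open>y\<close> in \<open>N(v)\<close>, since otherwise
  back arcs would combine into a closed walk shorter than \<open>g\<close>.  Then \<open>x\<close> has minimum out-degree too
  and \<open>N(x) = {y} \<union> N\<^sup>+\<^sup>+(v)\<close>, so there is a cycle inside \<open>N(x)\<close>.  Splicing it with a path
  from \<open>x\<close> inside \<open>N(v)\<close> yields a path of length exactly \<open>k\<close> between two adjacent vertices.

  The only remaining case is \<open>g = 3\<close>, \<open>k = 6\<close>.  There \<open>x\<close> as above cannot exist, and instead \<open>N(v)\<close>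
  contains a regular tournament on five vertices.  One of its vertices turns out to be a Seymour
  vertex, because its out-neighbourhood is not entered from a suitable \<open>w \<in> N\<^sup>+\<^sup>+(v)\<close>.
\<close>

section \<open>Paths and cycles as vertex lists\<close>

definition simple_path :: "('a \<Rightarrow> 'a \<Rightarrow> bool) \<Rightarrow> 'a list \<Rightarrow> bool" where
  "simple_path E xs \<longleftrightarrow> xs \<noteq> [] \<and> distinct xs \<and> successively E xs"

definition simple_cycle :: "('a \<Rightarrow> 'a \<Rightarrow> bool) \<Rightarrow> 'a list \<Rightarrow> bool" where
  "simple_cycle E xs \<longleftrightarrow> simple_path E xs \<and> E (last xs) (hd xs)"

lemma simple_path_Cons:
  "simple_path E (x # xs) \<longleftrightarrow> x \<notin> set xs \<and> (xs = [] \<or> E x (hd xs) \<and> simple_path E xs)"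
  by (auto simp: simple_path_def successively_Cons)

lemma simple_path_last: "simple_path E xs \<Longrightarrow> set xs \<subseteq> A \<Longrightarrow> last xs \<in> A"
  using last_in_set[of xs] by (auto simp: simple_path_def)

lemma simple_path_append:
  "simple_path E xs \<Longrightarrow> simple_path E ys \<Longrightarrow> set xs \<inter> set ys = {} \<Longrightarrow> E (last xs) (hd ys) \<Longrightarrow>
    simple_path E (xs @ ys)"
  by (auto simp: simple_path_def successively_append_iff)

lemma simple_path_take: "simple_path E xs \<Longrightarrow> 0 < n \<Longrightarrow> simple_path E (take n xs)"
  using successively_append_iff[of E "take n xs" "drop n xs"]
  by (auto simp: simple_path_def)

lemma simple_path_drop: "simple_path E xs \<Longrightarrow> n < length xs \<Longrightarrow> simple_path E (drop n xs)"
  using successively_append_iff[of E "take n xs" "drop n xs"]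
  by (auto simp: simple_path_def)

lemma simple_path_nth: "simple_path E xs \<Longrightarrow> Suc i < length xs \<Longrightarrow> E (xs ! i) (xs ! Suc i)"
proof (induction xs arbitrary: i)
  case (Cons x xs)
  then show ?case
    by (cases i) (auto simp: simple_path_Cons hd_conv_nth)
qed simp

lemma simple_path_relpowp:
  assumes "simple_path E xs" "i + n < length xs"
  shows "(E ^^ n) (xs ! i) (xs ! (i + n))"
  using assms(2)
proof (induction n)
  case (Suc n)
  then show ?case
    using simple_path_nth[OF assms(1), of "i + n"] by auto
qed simp

lemma simple_cycle_rotate1: "simple_cycle E xs \<Longrightarrow> simple_cycle E (rotate1 xs)"
  by (cases xs; cases "tl xs")
    (auto simp: simple_cycle_def simple_path_def successively_append_iff successively_Cons
      hd_append split: if_splits)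

lemma simple_cycle_rotate: "simple_cycle E xs \<Longrightarrow> simple_cycle E (rotate n xs)"
  by (induction n) (auto simp: simple_cycle_rotate1)

lemma simple_cycle_at:
  assumes "simple_cycle E xs" "x \<in> set xs"
  obtains ys where "simple_cycle E (x # ys)" "set (x # ys) = set xs" "length (x # ys) = length xs"
proof -
  obtain as bs where xs: "xs = as @ x # bs"
    using assms(2) by (meson split_list)
  have "rotate (length as) xs = x # bs @ as"
    by (simp add: xs rotate_append)
  then show thesis
    using that[of "bs @ as"] simple_cycle_rotate[OF assms(1), of "length as"]
    by (auto simp: xs)
qed

text \<open>Each extension by a new out-neighbour uses up a vertex of the finite set
  \<open>A\<close>, so the process stops.\<close>

lemma maximal_path_extension:
  assumes "finite A" "simple_path E xs" "set xs \<subseteq> A"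
  shows "\<exists>zs. simple_path E (xs @ zs) \<and> set (xs @ zs) \<subseteq> A \<and>
    {u \<in> A. E (last (xs @ zs)) u} \<subseteq> set (xs @ zs)"
  using assms(2,3)
proof (induction "card (A - set xs)" arbitrary: xs rule: less_induct)
  case less
  show ?case
  proof (cases "{u \<in> A. E (last xs) u} \<subseteq> set xs")
    case True
    then show ?thesis
      using less.prems by (intro exI[of _ "[]"]) auto
  next
    case False
    then obtain u where u: "u \<in> A" "E (last xs) u" "u \<notin> set xs"
      by auto
    have "card (A - set (xs @ [u])) < card (A - set xs)"
      using u assms(1) by (intro psubset_card_mono) auto
    moreover have "simple_path E (xs @ [u])"
      using u less.prems by (intro simple_path_append) (auto simp: simple_path_Cons)
    moreover have "set (xs @ [u]) \<subseteq> A"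
      using u less.prems by auto
    ultimately obtain zs where "simple_path E ((xs @ [u]) @ zs)" "set ((xs @ [u]) @ zs) \<subseteq> A"
      "{v \<in> A. E (last ((xs @ [u]) @ zs)) v} \<subseteq> set ((xs @ [u]) @ zs)"
      using less.hyps by blast
    then show ?thesis
      by (intro exI[of _ "u # zs"]) simp
  qed
qed

lemma maximal_path_from:
  assumes "finite A" "x \<in> A"
  obtains zs where "simple_path E (x # zs)" "set (x # zs) \<subseteq> A"
    "{u \<in> A. E (last (x # zs)) u} \<subseteq> set (x # zs)"
  using maximal_path_extension[OF assms(1), of E "[x]"] assms(2)
  by (auto simp: simple_path_Cons)

text \<open>The end of a maximal path in \<open>A\<close> has an out-neighbour in \<open>A\<close>,
  which must lie on the path; the segment from there to the end closes up.\<close>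

lemma simple_cycle_exists:
  assumes "finite A" "A \<noteq> {}" "\<And>a. a \<in> A \<Longrightarrow> \<exists>b \<in> A. E a b"
  obtains cs where "simple_cycle E cs" "set cs \<subseteq> A"
proof -
  obtain x zs where p: "simple_path E (x # zs)" "set (x # zs) \<subseteq> A"
    "{u \<in> A. E (last (x # zs)) u} \<subseteq> set (x # zs)"
    using assms(1,2) maximal_path_from by (metis ex_in_conv)
  let ?xs = "x # zs"
  have "last ?xs \<in> A"
    using p(1,2) by (rule simple_path_last)
  then obtain i where i: "i < length ?xs" "E (last ?xs) (?xs ! i)"
    using assms(3) p(3) by (metis (mono_tags, lifting) in_set_conv_nth mem_Collect_eq subsetD)
  show thesis
  proof (rule that)
    show "simple_cycle E (drop i ?xs)"
      using i simple_path_drop[OF p(1) i(1)] by (simp add: simple_cycle_def hd_drop_conv_nth)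
    show "set (drop i ?xs) \<subseteq> A"
      using p(2) by (meson set_drop_subset order_trans)
  qed
qed

section \<open>Digraphs without a Seymour vertex\<close>

text \<open>The setting of a counterexample, refuted at the end of this context.
  \<open>girth\<close> speaks of closed walks rather than cycles, so that arcs and path segments can
  be concatenated without checking distinctness. The \<open>Suc k\<close> vertices in
  \<open>no_shortcut\<close> make a path with \<open>k\<close> arcs.\<close>

locale no_seymour =
  fixes V :: "'a set" and E :: "'a \<Rightarrow> 'a \<Rightarrow> bool" and g k :: nat
  assumes finite_V: "finite V"
    and V_nonempty: "V \<noteq> {}"
    and arc_in_V: "E u v \<Longrightarrow> u \<in> V \<and> v \<in> V"
    and girth: "(E ^^ n) u u \<Longrightarrow> 0 < n \<Longrightarrow> g \<le> n"
    and g_ge_3: "3 \<le> g"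
    and k_pos: "0 < k"
    and k_le: "k \<le> g + 3"
    and no_shortcut: "simple_path E xs \<Longrightarrow> length xs = Suc k \<Longrightarrow> \<not> E (hd xs) (last xs)"
    and not_seymour: "v \<in> V \<Longrightarrow>
      card {w. \<not> E v w \<and> (\<exists>u. E v u \<and> E u w)} < card {u. E v u}"
begin

abbreviation N :: "'a \<Rightarrow> 'a set" where
  "N v \<equiv> {u. E v u}"

text \<open>The second out-neighbourhood of \<open>v\<close>; that \<open>v\<close> lies outside it
  follows from the absence of 2-cycles.\<close>

definition S :: "'a \<Rightarrow> 'a set" where
  "S v = {w. \<not> E v w \<and> (\<exists>u. E v u \<and> E u w)}"

definition min_degree :: "'a \<Rightarrow> bool" where
  "min_degree v \<longleftrightarrow> v \<in> V \<and> (\<forall>u \<in> V. card (N v) \<le> card (N u))"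

section \<open>Girth bounds and paths inside an out-neighbourhood\<close>

lemma no_loop: "\<not> E u u"
  using girth[of 1 u] g_ge_3 by auto

lemma no_2_cycle: "E u v \<Longrightarrow> \<not> E v u"
proof
  assume "E u v" "E v u"
  then have "(E ^^ 2) u u" by (auto simp: numeral_2_eq_2)
  from girth[OF this] show False using g_ge_3 by auto
qed

lemma no_3_cycle: "4 \<le> g \<Longrightarrow> E u v \<Longrightarrow> E v w \<Longrightarrow> \<not> E w u"
proof
  assume "4 \<le> g" "E u v" "E v w" "E w u"
  then have "(E ^^ 3) u u" by (auto simp: numeral_3_eq_3)
  from girth[OF this] show False using \<open>4 \<le> g\<close> by auto
qed

lemma finite_N [simp]: "finite (N v)"
  using finite_V by (rule rev_finite_subset) (auto dest: arc_in_V)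

lemma finite_S [simp]: "finite (S v)"
  using finite_V by (rule rev_finite_subset) (auto simp: S_def dest: arc_in_V)

lemma card_S: "v \<in> V \<Longrightarrow> card (S v) < card (N v)"
  using not_seymour by (simp add: S_def)

lemma not_in_S: "v \<notin> S v"
  by (auto simp: S_def no_2_cycle)

lemma min_degree_exists: "\<exists>v. min_degree v"
  using finite_V V_nonempty arg_min_if_finite(1)[of V "\<lambda>v. card (N v)"]
    arg_min_least[of V _ "\<lambda>v. card (N v)"]
  unfolding min_degree_def by blast

lemma min_degree_V: "min_degree v \<Longrightarrow> v \<in> V"
  by (simp add: min_degree_def)

text \<open>The path segment from index \<open>i\<close> to index \<open>j\<close>, followed by the
  walk back, is a closed walk of length \<open>j - i + m\<close>.\<close>

lemma back_walk:
  assumes "simple_path E xs" "i \<le> j" "j < length xs" "(E ^^ m) (xs ! j) (xs ! i)" "0 < m"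
  shows "i + g \<le> j + m"
proof -
  have "(E ^^ (j - i)) (xs ! i) (xs ! j)"
    using simple_path_relpowp[OF assms(1), of i "j - i"] assms(2,3) by simp
  then have "(E ^^ (j - i + m)) (xs ! i) (xs ! i)"
    using assms(4) by (meson relpowp_trans)
  from girth[OF this] show ?thesis using assms(2,5) by simp
qed

lemma back_arc:
  assumes "simple_path E xs" "i \<le> j" "j < length xs" "E (xs ! j) (xs ! i)"
  shows "i + g \<le> Suc j"
  using back_walk[OF assms(1-3), of 1] assms(4) by (simp add: eq_OO)

lemma cycle_length: "simple_cycle E cs \<Longrightarrow> g \<le> length cs"
  using back_arc[of cs 0 "length cs - 1"]
  by (auto simp: simple_cycle_def simple_path_def hd_conv_nth last_conv_nth)

lemma path_in_N_short:
  assumes "simple_path E xs" "set xs \<subseteq> N v"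
  shows "length xs < k"
proof (rule ccontr)
  assume "\<not> length xs < k"
  then have len: "k \<le> length xs" by simp
  let ?p = "v # take k xs"
  have tk: "simple_path E (take k xs)"
    using assms(1) k_pos simple_path_take by blast
  have sub: "set (take k xs) \<subseteq> N v"
    using assms(2) by (meson set_take_subset order_trans)
  have ne: "take k xs \<noteq> []"
    using tk by (simp add: simple_path_def)
  have "simple_path E ?p"
    using tk sub ne no_loop hd_in_set[OF ne] by (auto simp: simple_path_Cons)
  moreover have "length ?p = Suc k"
    using len by simp
  moreover have "E (hd ?p) (last ?p)"
    using sub ne last_in_set[OF ne] by (simp add: subset_iff)
  ultimately show False
    using no_shortcut by blast
qed

text \<open>
  \<open>N x - N v \<subseteq> S v\<close> and \<open>|S v| < |N v| \<le> |N x|\<close>, so a vertex with few out-neighbours inside \<open>N v\<close>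
  dominates all but few vertices of \<open>S v\<close>.
\<close>

lemma second_missed:
  assumes "min_degree v" "x \<in> N v"
  shows "card (S v - N x) < card (N x \<inter> N v)"
    and "card (N x) < card (N x \<inter> N v) + card (N v)"
proof -
  have sub: "N x - N v \<subseteq> S v"
    using assms(2) by (auto simp: S_def)
  have SN: "S v \<inter> N v = {}"
    by (auto simp: S_def)
  have 1: "card (N x) = card (N x \<inter> N v) + card (N x - N v)"
    by (subst card_Un_disjoint [symmetric]) (auto intro: arg_cong[where f = card])
  have "S v - N x = S v - (N x - N v)"
    using SN by auto
  then have 2: "card (S v - N x) = card (S v) - card (N x - N v)"
    using sub by (simp add: card_Diff_subset)
  have 3: "card (N x - N v) \<le> card (S v)"
    using sub by (simp add: card_mono)
  have 4: "card (N v) \<le> card (N x)"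
    using assms arc_in_V by (auto simp: min_degree_def)
  have 5: "card (S v) < card (N v)"
    using assms(1) card_S min_degree_V by blast
  show "card (S v - N x) < card (N x \<inter> N v)"
    using 1 2 3 4 5 by linarith
  show "card (N x) < card (N x \<inter> N v) + card (N v)"
    using 1 3 5 by linarith
qed

lemma inner_succ:
  assumes "min_degree v" "x \<in> N v"
  shows "\<exists>y \<in> N v. E x y"
proof -
  have "N x \<inter> N v \<noteq> {}"
    using second_missed(1)[OF assms] by (metis card.empty not_less_zero)
  then show ?thesis by auto
qed

lemma path_end_succs:
  assumes "simple_path E xs" "{u \<in> A. E (last xs) u} \<subseteq> set xs"
  shows "{u \<in> A. E (last xs) u} \<subseteq> (!) xs ` {i. i + g \<le> length xs}"
proof
  fix u assume u: "u \<in> {u \<in> A. E (last xs) u}"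
  then obtain i where i: "i < length xs" "u = xs ! i"
    using assms(2) by (metis (no_types, lifting) in_set_conv_nth subsetD)
  have "E (xs ! (length xs - 1)) (xs ! i)"
    using u i assms(1) by (auto simp: last_conv_nth simple_path_def)
  moreover have "i \<le> length xs - 1" "length xs - 1 < length xs"
    using i(1) by linarith+
  ultimately have "i + g \<le> length xs"
    using back_arc[OF assms(1)] by fastforce
  then show "u \<in> (!) xs ` {i. i + g \<le> length xs}"
    using i(2) by blast
qed

lemma card_path_end_succs:
  assumes "simple_path E xs" "{u \<in> A. E (last xs) u} \<subseteq> set xs"
  shows "card {u \<in> A. E (last xs) u} \<le> Suc (length xs) - g"
proof -
  have eq: "{i. i + g \<le> length xs} = {..<Suc (length xs) - g}"
    by auto
  show ?thesis
    using card_mono[OF _ path_end_succs[OF assms]] card_image_le[of "{i. i + g \<le> length xs}" "(!) xs"]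
    by (simp add: eq)
qed

lemma maximal_path_length:
  assumes "min_degree v" "simple_path E xs" "set xs \<subseteq> N v" "{u \<in> N v. E (last xs) u} \<subseteq> set xs"
  shows "g \<le> length xs" "length xs < k"
proof -
  have "last xs \<in> N v"
    using assms(2,3) by (rule simple_path_last)
  then have "{u \<in> N v. E (last xs) u} \<noteq> {}"
    using inner_succ[OF assms(1)] by auto
  then have "{i. i + g \<le> length xs} \<noteq> {}"
    using path_end_succs[OF assms(2,4)] by auto
  then show "g \<le> length xs" by auto
  show "length xs < k" by (rule path_in_N_short[OF assms(2,3)])
qed

section \<open>Vertices with a single out-neighbour inside \<open>N v\<close>\<close>

lemma unique_succ:
  assumes "min_degree v" "x \<in> N v" "N x \<inter> N v = {y}"
  shows "min_degree x" "S v \<subseteq> N x" "N x = insert y (S v)"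
proof -
  \<comment> \<open>With a single inner out-neighbour, both strict bounds of
    \<open>second_missed\<close> become tight.\<close>
  have "card (S v - N x) = 0"
    using second_missed(1)[OF assms(1,2)] assms(3) by simp
  then show sub: "S v \<subseteq> N x" by simp
  have "card (N x) \<le> card (N v)"
    using second_missed(2)[OF assms(1,2)] assms(3) by simp
  then show "min_degree x"
    using assms(1,2) arc_in_V by (fastforce simp: min_degree_def)
  show "N x = insert y (S v)"
    using sub assms(2,3) by (auto simp: S_def)
qed

text \<open>Since \<open>x\<close> again has minimum out-degree, \<open>N x = insert y (S v)\<close>
  contains a cycle, which has at least \<open>g\<close> vertices. The path inside \<open>N v\<close>
  starts with \<open>x, y\<close>, and \<open>long\<close> ensures that path and cycle together
  supply enough vertices for a path with exactly \<open>k\<close> arcs.\<close>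

lemma no_long_maximal_path_from_unique_succ:
  assumes v: "min_degree v" and x: "x \<in> N v" "N x \<inter> N v = {y}"
    and p: "simple_path E (x # zs)" "set (x # zs) \<subseteq> N v"
      "{u \<in> N v. E (last (x # zs)) u} \<subseteq> set (x # zs)"
    and long: "k < g + length (x # zs)"
  shows False
proof -
  let ?ys = "x # zs"
  have SN: "S v \<inter> N v = {}"
    by (auto simp: S_def)
  have len: "g \<le> length ?ys" "length ?ys < k"
    using maximal_path_length[OF v p] by auto
  have zs_ne: "zs \<noteq> []"
    using len g_ge_3 by auto
  have "hd zs \<in> N v"
    using p(2) hd_in_set[OF zs_ne] by (metis set_subset_Cons subsetD)
  then have "hd zs \<in> N x \<inter> N v"
    using p(1) zs_ne by (auto simp: simple_path_Cons)
  then have hd_zs: "hd zs = y"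
    using x(2) by auto
  have min_x: "min_degree x" and Sv: "S v \<subseteq> N x" and Nx: "N x = insert y (S v)"
    using unique_succ[OF v x] by auto
  have "N x \<noteq> {}" "\<And>a. a \<in> N x \<Longrightarrow> \<exists>b \<in> N x. E a b"
    using Nx inner_succ[OF min_x] by auto
  then obtain cs where cs: "simple_cycle E cs" "set cs \<subseteq> N x"
    using simple_cycle_exists[of "N x" E] by auto
  have len_cs: "g \<le> length cs"
    by (rule cycle_length[OF cs(1)])
  show False
  proof (cases "y \<in> set cs")
    \<comment> \<open>The forbidden path is \<open>v, x\<close>, then \<open>g - 1\<close> vertices of \<open>S v\<close> along the cycle, then \<open>y\<close> and
      onwards along \<open>zs\<close>; it ends in \<open>N v\<close>.\<close>
    case True
    then obtain ws where ws: "simple_cycle E (y # ws)" "set (y # ws) = set cs"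
      "length (y # ws) = length cs"
      using simple_cycle_at[OF cs(1)] by metis
    \<comment> \<open>The last \<open>g - 1\<close> vertices before the cycle returns to
      \<open>y\<close>. Together with \<open>v\<close>, \<open>x\<close> and \<open>k - g\<close>
      vertices of \<open>zs\<close> they make \<open>k + 1\<close>.\<close>
    define us where "us = drop (length ws - (g - 1)) ws"
    have lus: "length us = g - 1"
      using ws(3) len_cs by (auto simp: us_def)
    have us_ne: "us \<noteq> []"
      using lus g_ge_3 by auto
    have "set us \<subseteq> set ws"
      by (simp add: us_def set_drop_subset)
    moreover have "set ws \<subseteq> S v"
      using ws(1,2) cs(2) Nx by (auto simp: simple_cycle_def simple_path_Cons)
    ultimately have us_S: "set us \<subseteq> S v" by simp
    have ws_ne: "ws \<noteq> []"
      using us_ne by (auto simp: us_def)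
    have us_path: "simple_path E us"
      unfolding us_def
      using ws(1) ws_ne lus us_def us_ne
      by (intro simple_path_drop) (auto simp: simple_cycle_def simple_path_Cons)
    have us_last: "E (last us) y"
      using ws(1) ws_ne us_ne by (auto simp: simple_cycle_def us_def)
    have k_g: "0 < k - g" "k - g \<le> length zs"
      using len long by auto
    define ts where "ts = take (k - g) zs"
    have ts_ne: "ts \<noteq> []"
      using k_g zs_ne by (auto simp: ts_def)
    have ts_N: "set ts \<subseteq> N v - {x}"
      using p(1,2) by (auto simp: ts_def simple_path_Cons dest: in_set_takeD)
    have ts_hd: "hd ts = y"
      using hd_zs k_g by (simp add: ts_def)
    have ts_path: "simple_path E ts"
      unfolding ts_def using p(1) k_g zs_ne by (intro simple_path_take) (auto simp: simple_path_Cons)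
    have "simple_path E (us @ ts)"
      using us_path ts_path us_last ts_hd SN us_S ts_N by (intro simple_path_append) auto
    moreover have "hd (us @ ts) \<in> N x"
      using us_ne us_S Sv by (metis hd_append2 hd_in_set subsetD)
    ultimately have "simple_path E (v # x # us @ ts)"
      using x(1) SN us_S ts_N us_ne no_loop not_in_S[of v] by (auto simp: simple_path_Cons)
    moreover have "length (v # x # us @ ts) = Suc k"
      using lus k_g g_ge_3 by (simp add: ts_def)
    moreover have "last ts \<in> N v"
      using ts_N ts_ne by (metis DiffD1 last_in_set subsetD)
    then have "E (hd (v # x # us @ ts)) (last (v # x # us @ ts))"
      using ts_ne by simp
    ultimately show False
      using no_shortcut by blast
  next
    \<comment> \<open>The end of the maximal path misses fewer than \<open>g\<close> vertices of \<open>S v\<close>, hence not all of the cycle,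
      and the path continues along the cycle up to length \<open>k\<close>; it ends in \<open>S v \<subseteq> N x\<close>.\<close>
    case False
    then have cs_S: "set cs \<subseteq> S v"
      using cs(2) Nx by auto
    let ?e = "last ?ys"
    have e: "?e \<in> N v"
      by (rule simple_path_last[OF p(1,2)])
    have "N ?e \<inter> N v = {u \<in> N v. E ?e u}"
      by auto
    then have "card (S v - N ?e) < Suc (length ?ys) - g"
      using second_missed(1)[OF v e] card_path_end_succs[OF p(1,3)] by simp
    \<comment> \<open>Here \<open>length ?ys < k \<le> g + 3\<close>, so the bound is at most 3,
      while the cycle has at least \<open>g \<ge> 3\<close> vertices.\<close>
    also have "\<dots> \<le> length cs"
      using len len_cs k_le g_ge_3 by linarith
    finally have "card (S v - N ?e) < card (set cs)"
      using cs(1) by (simp add: simple_cycle_def simple_path_def distinct_card)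
    then have "\<not> set cs \<subseteq> S v - N ?e"
      by (meson card_mono finite_Diff finite_S not_le)
    then obtain w where w: "w \<in> set cs" "E ?e w"
      using cs_S by auto
    obtain ws where ws: "simple_cycle E (w # ws)" "set (w # ws) = set cs"
      "length (w # ws) = length cs"
      using simple_cycle_at[OF cs(1) w(1)] by metis
    let ?m = "Suc k - length ?ys"
    define us where "us = take ?m (w # ws)"
    have m: "0 < ?m" "?m \<le> length (w # ws)"
      using len long ws(3) len_cs by auto
    have us_S: "set us \<subseteq> S v"
      using cs_S ws(2) set_take_subset[of ?m "w # ws"] by (simp add: us_def)
    have us_ne: "us \<noteq> []"
      using m by (auto simp: us_def)
    have us_path: "simple_path E us"
      using ws(1) m(1) unfolding simple_cycle_def us_def by (blast intro: simple_path_take)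
    have "E ?e (hd us)"
      using w(2) m(1) by (simp add: us_def)
    then have "simple_path E (?ys @ us)"
      using p(2) us_S SN by (intro simple_path_append p(1) us_path) auto
    moreover have "length (?ys @ us) = Suc k"
      using m len by (simp add: us_def)
    moreover have "last us \<in> N x"
      using us_ne us_S Sv by (metis last_in_set subsetD)
    then have "E (hd (?ys @ us)) (last (?ys @ us))"
      using us_ne by simp
    ultimately show False
      using no_shortcut by blast
  qed
qed

section \<open>At least two out-neighbours inside \<open>N v\<close> for every vertex of
  \<open>N v\<close>\<close>

lemma two_succs:
  assumes "min_degree v" "\<And>x. x \<in> N v \<Longrightarrow> card (N x \<inter> N v) \<noteq> 1" "x \<in> N v"
  shows "\<exists>u \<in> N v. E x u \<and> u \<noteq> a"
proof (rule ccontr)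
  assume "\<not> ?thesis"
  then have sub: "N x \<inter> N v \<subseteq> {a}" by auto
  moreover have "N x \<inter> N v \<noteq> {}"
    using inner_succ[OF assms(1,3)] by auto
  ultimately have "N x \<inter> N v = {a}" by auto
  then show False
    using assms(2)[OF assms(3)] by simp
qed

lemma full_path_succs:
  assumes "simple_path E xs" "set xs \<subseteq> N v" "k \<le> Suc (length xs)" "E (last xs) u" "u \<in> N v"
  shows "u \<in> set xs"
proof (rule ccontr)
  assume "u \<notin> set xs"
  then have "simple_path E (xs @ [u])"
    using assms by (intro simple_path_append) (auto simp: simple_path_Cons)
  from path_in_N_short[OF this, of v] show False
    using assms by auto
qed

text \<open>Rotating the cycle makes \<open>c\<close> the end of a path that is already too long to
  be extended inside \<open>N v\<close>.\<close>

lemma full_cycle_succs: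
  assumes "simple_cycle E cs" "set cs \<subseteq> N v" "k \<le> Suc (length cs)" "c \<in> set cs" "E c u" "u \<in> N v"
  shows "u \<in> set cs"
proof -
  obtain ys where ys: "simple_cycle E (c # ys)" "set (c # ys) = set cs"
      "length (c # ys) = length cs"
    using simple_cycle_at[OF assms(1,4)] by metis
  have "simple_cycle E (rotate1 (c # ys))"
    using ys(1) by (rule simple_cycle_rotate1)
  then show ?thesis
    using full_path_succs[of "ys @ [c]" v u] assms ys by (auto simp: simple_cycle_def)
qed

text \<open>As \<open>k \<le> g + 3\<close>, no arc inside \<open>N v\<close> leaves the cycle. A
  second arc out of the last vertex, then second arcs out of the vertices reached, can only go to
  small indices, and each possibility closes a walk of length at most 3.\<close>

lemma no_cycle_of_length_g_plus_2:
  assumes v: "min_degree v" and deg: "\<And>x. x \<in> N v \<Longrightarrow> card (N x \<inter> N v) \<noteq> 1"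
    and cs: "simple_cycle E cs" "set cs \<subseteq> N v" "length cs = g + 2" and g: "4 \<le> g"
  shows False
proof -
  have path: "simple_path E cs"
    using cs(1) by (simp add: simple_cycle_def)
  have arc: "E (cs ! i) (cs ! Suc i)" if "i \<le> g" for i
    using simple_path_nth[OF path, of i] that cs(3) by simp
  have arc01: "E (cs ! 0) (cs ! 1)"
    using arc[of 0] by simp
  have arc12: "E (cs ! 1) (cs ! 2)" and arc23: "E (cs ! 2) (cs ! 3)"
    using arc[of 1] arc[of 2] g by (simp_all add: numeral_2_eq_2 numeral_3_eq_3)
  \<comment> \<open>The parameter \<open>a\<close> is an index to be avoided; below it is always the
    next vertex on the cycle.\<close>
  have next_succ: "\<exists>j < g + 2. E (cs ! i) (cs ! j) \<and> j \<noteq> a" if i: "i < g + 2" for i a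
  proof -
    have "cs ! i \<in> N v"
      using cs(2,3) i by (metis nth_mem subsetD)
    then obtain u where u: "u \<in> N v" "E (cs ! i) u" "u \<noteq> cs ! a"
      using two_succs[OF v deg] by blast
    have "u \<in> set cs"
      using full_cycle_succs[OF cs(1,2) _ _ u(2,1)] i cs(3) k_le by simp
    then show ?thesis
      using u by (metis cs(3) in_set_conv_nth)
  qed
  have back_bound: "i \<le> m + 1" if "(E ^^ m) (cs ! (g + 1)) (cs ! i)" "0 < m" "i < g + 2" for i m
    using back_walk[OF path, of i "g + 1" m] that cs(3) by simp
  have "cs \<noteq> []"
    using cs(3) by auto
  then have closing: "E (cs ! (g + 1)) (cs ! 0)"
    using cs by (simp add: simple_cycle_def hd_conv_nth last_conv_nth)
  obtain i where i: "i < g + 2" "E (cs ! (g + 1)) (cs ! i)" "i \<noteq> 0"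
    using next_succ[of "g + 1" 0] by auto
  have "i \<le> 2"
    using back_bound[of 1 i] i by (simp add: eq_OO)
  with i(3) consider "i = 2" | "i = 1"
    by linarith
  then show False
  proof cases
    case 1
    obtain j where j: "j < g + 2" "E (cs ! 2) (cs ! j)" "j \<noteq> 3"
      using next_succ[of 2 3] g by auto
    have "(E ^^ 2) (cs ! (g + 1)) (cs ! j)"
      using i j 1 by (auto simp: numeral_2_eq_2)
    then have "j \<le> 3"
      using back_bound[of 2 j] j(1) by simp
    \<comment> \<open>Index 0 closes a 3-cycle through the vertices 0, 1, 2; index 1 closes a
      2-cycle and index 2 a loop.\<close>
    with j(3) consider "j = 0" | "j = 1" | "j = 2"
      by linarith
    then show False
      by cases (use arc01 arc12 j(2) no_loop no_2_cycle no_3_cycle[OF g] in metis)+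
  next
    case 2
    obtain j where j: "j < g + 2" "E (cs ! 1) (cs ! j)" "j \<noteq> 2"
      using next_succ[of 1 2] g by auto
    have "(E ^^ 2) (cs ! (g + 1)) (cs ! j)"
      using i j 2 by (auto simp: numeral_2_eq_2)
    then have "j \<le> 3"
      using back_bound[of 2 j] j(1) by simp
    moreover have "j \<noteq> 0" "j \<noteq> 1"
      using arc01 j(2) no_loop no_2_cycle by metis+
    ultimately have j3: "j = 3"
      using j(3) by linarith
    obtain l where l: "l < g + 2" "E (cs ! 3) (cs ! l)" "l \<noteq> 4"
      using next_succ[of 3 4] g by auto
    have "(E ^^ 3) (cs ! (g + 1)) (cs ! l)"
      using i j l 2 j3 by (auto simp: numeral_3_eq_3)
    then have "l \<le> 4"
      using back_bound[of 3 l] l(1) by simp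
    with l(3) consider "l = 0" | "l = 1" | "l = 2" | "l = 3"
      by linarith
    then show False
      by cases (use arc01 arc23 j(2) j3 l(2) no_loop no_2_cycle no_3_cycle[OF g] in metis)+
  qed
qed

text \<open>The second out-neighbour \<open>u\<close> of \<open>cs ! 1\<close> lies off the cycle,
  by the girth. Going once round from \<open>cs ! 2\<close> to \<open>cs ! 1\<close> and on to
  \<open>u\<close> gives a path on \<open>g + 2\<close> vertices, and the girth forces
  \<open>u\<close> back to \<open>cs ! 2\<close>, which closes a cycle of the length excluded
  before.\<close>

lemma no_cycle_of_length_g_plus_1_with_chord:
  assumes v: "min_degree v" and deg: "\<And>x. x \<in> N v \<Longrightarrow> card (N x \<inter> N v) \<noteq> 1"
    and cs: "simple_cycle E cs" "set cs \<subseteq> N v" "length cs = g + 1"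
    and chord: "E (cs ! g) (cs ! 1)" and k: "k < 2 * g"
  shows False
proof -
  have path: "simple_path E cs"
    using cs(1) by (simp add: simple_cycle_def)
  have arc: "E (cs ! i) (cs ! Suc i)" if "i < g" for i
    using simple_path_nth[OF path, of i] that cs(3) by simp
  have arc01: "E (cs ! 0) (cs ! 1)"
    using arc[of 0] g_ge_3 by simp
  have back_bound: "i \<le> m" if "(E ^^ m) (cs ! g) (cs ! i)" "0 < m" "i < g + 1" for i m
    using back_walk[OF path, of i g m] that cs(3) by simp
  have c1: "cs ! 1 \<in> N v"
    using cs(2,3) g_ge_3 nth_mem[of 1 cs] by (simp add: subset_iff)
  obtain u where u: "u \<in> N v" "E (cs ! 1) u" "u \<noteq> cs ! 2"
    using two_succs[OF v deg c1] by blast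
  have u_notin: "u \<notin> set cs"
  proof
    assume "u \<in> set cs"
    then obtain j where j: "j < g + 1" "u = cs ! j"
      by (metis cs(3) in_set_conv_nth)
    have "(E ^^ 2) (cs ! g) (cs ! j)"
      using chord u j by (auto simp: numeral_2_eq_2)
    then have "j \<le> 2"
      using back_bound[of 2 j] j(1) by simp
    moreover have "j \<noteq> 2" "j \<noteq> 0" "j \<noteq> 1"
      using arc01 u(2,3) j(2) no_loop no_2_cycle by metis+
    ultimately show False by linarith
  qed
  define ps where "ps = rotate 2 cs"
  have ps: "simple_path E ps" "set ps = set cs" "length ps = g + 1"
    using simple_cycle_rotate[OF cs(1), of 2] cs(3) by (auto simp: simple_cycle_def ps_def)
  have ps_ne: "ps \<noteq> []"
    using ps(3) by auto
  have "last ps = cs ! ((2 + g) mod (g + 1))"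
    using ps(3) ps_ne cs(3) by (simp add: last_conv_nth ps_def nth_rotate)
  also have "(2 + g) mod (g + 1) = 1"
    using g_ge_3 mod_add_self2[of 1 "g + 1"] by (simp add: add.commute)
  finally have last_ps: "last ps = cs ! 1" .
  have hd_ps: "hd ps = cs ! 2"
    using cs(3) g_ge_3 by (subst ps_def, subst hd_rotate_conv_nth) auto
  have psu: "simple_path E (ps @ [u])" "set (ps @ [u]) \<subseteq> N v"
    using ps(1,2) u u_notin cs(2) last_ps
    by (auto intro!: simple_path_append simp: simple_path_Cons)
  have "g + 2 < k"
    using path_in_N_short[OF psu] ps(3) by simp
  \<comment> \<open>The path just found forces \<open>k = g + 3\<close>, and then
    \<open>k < 2 * g\<close> excludes \<open>g = 3\<close>.\<close>
  then have g4: "4 \<le> g"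
    using k k_le by linarith
  have succ_u: "\<exists>j. w = cs ! j \<and> (j = 2 \<or> j = 3)" if w: "w \<in> N v" "E u w" for w
  proof -
    have "w \<in> set (ps @ [u])"
      using full_path_succs[OF psu] w ps(3) k_le by simp
    then have "w \<in> set cs"
      using ps(2) w(2) no_loop by auto
    then obtain j where j: "j < g + 1" "w = cs ! j"
      by (metis cs(3) in_set_conv_nth)
    have "(E ^^ 3) (cs ! g) (cs ! j)"
      using chord u w j by (auto simp: numeral_3_eq_3)
    then have "j \<le> 3"
      using back_bound[of 3 j] j(1) by simp
    moreover have "j \<noteq> 0" "j \<noteq> 1"
      using arc01 u(2) w(2) j(2) no_2_cycle no_3_cycle[OF g4] by metis+
    ultimately show ?thesis
      using j(2) by (intro exI[of _ j]) auto
  qed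
  obtain w where w: "w \<in> N v" "E u w" "w \<noteq> cs ! 3"
    using two_succs[OF v deg u(1)] by blast
  then have "E u (cs ! 2)"
    using succ_u by auto
  then have "simple_cycle E (ps @ [u])"
    using psu(1) hd_ps ps_ne by (simp add: simple_cycle_def)
  then show False
    using no_cycle_of_length_g_plus_2[OF v deg _ psu(2)] ps(3) g4 by simp
qed

lemma unique_succ_exists:
  assumes v: "min_degree v" and k: "k < 2 * g"
  shows "\<exists>x \<in> N v. \<exists>y. N x \<inter> N v = {y}"
proof (rule ccontr)
  assume contr: "\<not> ?thesis"
  then have deg: "card (N x \<inter> N v) \<noteq> 1" if "x \<in> N v" for x
    using that by (metis card_1_singletonE)
  have "N v \<noteq> {}"
    using card_S[OF min_degree_V[OF v]] by (metis card.empty not_less_zero)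
  then obtain x zs where p: "simple_path E (x # zs)" "set (x # zs) \<subseteq> N v"
    "{u \<in> N v. E (last (x # zs)) u} \<subseteq> set (x # zs)"
    using maximal_path_from[of "N v" _ E] by (metis ex_in_conv finite_N)
  define xs where "xs = x # zs"
  note p = p[folded xs_def]
  have len: "g \<le> length xs" "length xs < k"
    using maximal_path_length[OF v p] by auto
  have end_N: "last xs \<in> N v"
    by (rule simple_path_last[OF p(1,2)])
  have next_succ: "\<exists>i. i + g \<le> length xs \<and> E (last xs) (xs ! i) \<and> i \<noteq> a" for a
  proof -
    obtain u where u: "u \<in> N v" "E (last xs) u" "u \<noteq> xs ! a"
      using two_succs[OF v deg end_N] by blast
    then show ?thesis
      using path_end_succs[OF p(1,3)] by auto
  qed
  \<comment> \<open>Two distinct arcs back from the end are available. Avoiding index 0 excludes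
    length \<open>g\<close>; avoiding 1 and 2 in turn determines the targets in the remaining
    cases.\<close>
  obtain i where i: "i + g \<le> length xs" "E (last xs) (xs ! i)" "i \<noteq> 0"
    using next_succ by blast
  obtain j where j: "j + g \<le> length xs" "E (last xs) (xs ! j)" "j \<noteq> 1"
    using next_succ by blast
  obtain l where l: "l + g \<le> length xs" "E (last xs) (xs ! l)" "l \<noteq> 2"
    using next_succ by blast
  have last_nth: "last xs = xs ! (length xs - 1)"
    by (simp add: xs_def last_conv_nth)
  have cyc: "simple_cycle E xs" if "E (last xs) (xs ! 0)"
    using that p(1) by (simp add: simple_cycle_def xs_def)
  consider "length xs = g + 1" | "length xs = g + 2"
    using len k_le i by linarith
  then show False
  proof cases
    case 1
    have "i = 1" "j = 0"
      using 1 i(1,3) j(1,3) by linarith+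
    then have "E (last xs) (xs ! 0)" "E (xs ! g) (xs ! 1)"
      using 1 i(2) j(2) last_nth by auto
    then show False
      using no_cycle_of_length_g_plus_1_with_chord[OF v deg cyc p(2) 1 _ k] by simp
  next
    case 2
    show False
    proof (cases "E (last xs) (xs ! 0)")
      case True
      then show False
        using no_cycle_of_length_g_plus_2[OF v deg cyc p(2) 2] len 2 k by simp
    next
      case False
      then have "j \<noteq> 0" "l \<noteq> 0"
        using j(2) l(2) by metis+
      then have jl: "j = 2" "l = 1"
        using 2 j l by auto
      \<comment> \<open>Without an arc to index 0, dropping the first vertex leaves a cycle on
        \<open>g + 1\<close> vertices together with its chord.\<close>
      have zs: "zs \<noteq> []" "length zs = g + 1"
        using 2 g_ge_3 by (auto simp: xs_def)
      have "simple_cycle E zs"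
        using p(1) l(2) jl zs by (simp add: simple_cycle_def xs_def simple_path_Cons hd_conv_nth)
      moreover have "E (zs ! g) (zs ! 1)"
        using j(2) jl zs by (simp add: xs_def last_conv_nth numeral_2_eq_2)
      ultimately show False
        using no_cycle_of_length_g_plus_1_with_chord[OF v deg _ _ zs(2) _ k] p(2)
        by (simp add: xs_def)
    qed
  qed
qed

lemma k_ge: "2 * g \<le> k"
proof (rule ccontr)
  assume "\<not> 2 * g \<le> k"
  then have k: "k < 2 * g" by simp
  obtain v where v: "min_degree v"
    using min_degree_exists by blast
  obtain x y where x: "x \<in> N v" "N x \<inter> N v = {y}"
    using unique_succ_exists[OF v k] by blast
  obtain zs where p: "simple_path E (x # zs)" "set (x # zs) \<subseteq> N v"
    "{u \<in> N v. E (last (x # zs)) u} \<subseteq> set (x # zs)"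
    using maximal_path_from[OF finite_N x(1)] by blast
  have "g \<le> length (x # zs)"
    by (rule maximal_path_length[OF v p])
  then show False
    using no_long_maximal_path_from_unique_succ[OF v x p] k by simp
qed

subsection \<open>The case \<open>k = 6\<close>\<close>

lemma g_eq: "g = 3" and k_eq: "k = 6"
  using k_ge k_le g_ge_3 by linarith+

text \<open>
  Here \<open>x \<rightarrow> y \<rightarrow> z \<rightarrow> x\<close> is forced to be the only way on from \<open>x\<close> inside \<open>N v\<close>, and \<open>S v \<subseteq> N z\<close>.
  A vertex of \<open>S v\<close> with a single out-neighbour in \<open>N x\<close> would dominate \<open>z \<in> S x\<close>, closing a
  2-cycle; so every vertex of \<open>S v\<close> has two, which leaves room for a shortcut.
\<close>

lemma no_unique_succ:
  assumes v: "min_degree v" and x: "x \<in> N v"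
  shows "N x \<inter> N v \<noteq> {y}"
proof
  assume y: "N x \<inter> N v = {y}"
  have min_x: "min_degree x" and Sv: "S v \<subseteq> N x" and Nx: "N x = insert y (S v)"
    using unique_succ[OF v x y] by auto
  have SN: "S v \<inter> N v = {}"
    by (auto simp: S_def)
  have xy: "E x y" "y \<in> N v"
    using y by auto
  obtain z where z: "z \<in> N v" "E y z"
    using inner_succ[OF v xy(2)] by auto
  have z_neq: "z \<noteq> x" "z \<noteq> y" "x \<noteq> y"
    using z xy no_loop no_2_cycle by metis+
  \<comment> \<open>Any other \<open>u\<close> would give a maximal path from \<open>x\<close> with
    at least 4 vertices, and \<open>k = 6 < 3 + 4\<close>.\<close>
  have "u = x" if u: "u \<in> N v" "E z u" for u
  proof (rule ccontr)
    assume "u \<noteq> x"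
    moreover have "u \<noteq> y" "u \<noteq> z"
      using u(2) z(2) no_loop no_2_cycle by metis+
    ultimately have "simple_path E [x, y, z, u]"
      using z_neq xy z u by (auto simp: simple_path_Cons)
    moreover have "set [x, y, z, u] \<subseteq> N v"
      using x xy z u by simp
    ultimately obtain ws where "simple_path E ([x, y, z, u] @ ws)" "set ([x, y, z, u] @ ws) \<subseteq> N v"
      "{w \<in> N v. E (last ([x, y, z, u] @ ws)) w} \<subseteq> set ([x, y, z, u] @ ws)"
      using maximal_path_extension[OF finite_N] by blast
    then show False
      using no_long_maximal_path_from_unique_succ[OF v x y, of "[y, z, u] @ ws"]
      by (simp add: g_eq k_eq)
  qed
  then have "N z \<inter> N v = {x}"
    using inner_succ[OF v z(1)] by auto
  then have Sv_z: "S v \<subseteq> N z"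
    using unique_succ(2)[OF v z(1)] by simp
  have "z \<in> S x"
    using y z xy z_neq by (auto simp: S_def)
  have succ: "\<exists>w \<in> N x. E u w \<and> w \<noteq> a" if u: "u \<in> S v" for u a
  proof (rule ccontr)
    assume contr: "\<not> ?thesis"
    have u_x: "u \<in> N x"
      using Sv u by auto
    have "N u \<inter> N x = {a}"
      using contr inner_succ[OF min_x u_x] by auto
    from unique_succ(2)[OF min_x u_x this] have "E u z"
      using \<open>z \<in> S x\<close> by auto
    moreover have "E z u"
      using Sv_z u by auto
    ultimately show False
      using no_2_cycle by blast
  qed
  \<comment> \<open>Prefixing \<open>x, y, z\<close> gives 7 vertices: \<open>z\<close> dominates
    the first vertex of \<open>ws\<close> and \<open>x\<close> the last.\<close>
  have no_path_4: False if ws: "simple_path E ws" "set ws \<subseteq> S v" "length ws = 4" for ws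
  proof -
    have "ws \<noteq> []"
      using ws(3) by auto
    then have "hd ws \<in> N z" "last ws \<in> N x"
      using ws(2) Sv Sv_z by (meson hd_in_set last_in_set subsetD)+
    then have "simple_path E (x # y # z # ws)"
      using ws x xy z z_neq SN by (auto simp: simple_path_Cons)
    moreover have "length (x # y # z # ws) = Suc k"
      using ws(3) by (simp add: k_eq)
    moreover have "E (hd (x # y # z # ws)) (last (x # y # z # ws))"
      using \<open>ws \<noteq> []\<close> \<open>last ws \<in> N x\<close> by simp
    ultimately show False
      using no_shortcut by blast
  qed
  have "S v \<noteq> {}"
    using inner_succ[OF min_x, of y] Nx no_loop by auto
  moreover have "\<exists>w \<in> S v. E u w" if "u \<in> S v" for u
    using succ[OF that, of y] Nx by auto
  ultimately obtain cs where cs: "simple_cycle E cs" "set cs \<subseteq> S v"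
    using simple_cycle_exists[of "S v" E] by auto
  have "length cs < 4"
  proof (rule ccontr)
    assume "\<not> length cs < 4"
    then show False
      using no_path_4[of "take 4 cs"] cs simple_path_take[of E cs 4]
      by (auto simp: simple_cycle_def dest: in_set_takeD)
  qed
  then have "length cs = 3"
    using cycle_length[OF cs(1)] g_eq by simp
  then obtain a b c where abc: "cs = [a, b, c]"
    by (auto simp: numeral_3_eq_3 length_Suc_conv)
  have arcs: "E a b" "E b c" "a \<noteq> b" "a \<noteq> c" "b \<noteq> c" "a \<in> S v" "b \<in> S v" "c \<in> S v"
    using cs by (auto simp: abc simple_cycle_def simple_path_Cons)
  \<comment> \<open>A further out-neighbour of \<open>c\<close> in \<open>S v\<close> would extend
    the triangle to a path on 4 vertices, so it is \<open>y\<close>, and the triangle can be left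
    towards \<open>y, z\<close>.\<close>
  obtain w where w: "w \<in> N x" "E c w" "w \<noteq> a"
    using succ[of c a] arcs by blast
  have "w \<notin> S v"
  proof
    assume "w \<in> S v"
    moreover have "w \<noteq> b" "w \<noteq> c"
      using arcs(2) w(2) no_loop no_2_cycle by metis+
    ultimately show False
      using no_path_4[of "[a, b, c, w]"] arcs w by (simp add: simple_path_Cons)
  qed
  then have "E c y"
    using w Nx by auto
  have "a \<in> N x"
    using Sv arcs by auto
  have "simple_path E [v, x, a, b, c, y, z]"
    using arcs x xy z z_neq \<open>E c y\<close> \<open>a \<in> N x\<close> SN no_loop[of v] not_in_S[of v]
    by (auto simp: simple_path_Cons)
  then show False
    using no_shortcut[of "[v, x, a, b, c, y, z]"] z(1) by (simp add: k_eq)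
qed

section \<open>A regular tournament on five vertices inside \<open>N v\<close>\<close>

lemma two_inner_succs:
  assumes "min_degree v" "x \<in> N v"
  shows "\<exists>u \<in> N v. E x u \<and> u \<noteq> a"
  using two_succs[OF assms(1) _ assms(2)] no_unique_succ[OF assms(1)]
  by (metis card_1_singletonE)

text \<open>If no 5-cycle exists, a second out-neighbour \<open>u\<close> of \<open>b\<close> is a
  new vertex. Paths on all five vertices cannot be extended inside \<open>N v\<close>, which forces
  the arcs from \<open>u\<close> to \<open>a\<close> and \<open>d\<close> and from \<open>c\<close>
  to \<open>a\<close>; then nothing is left as a second out-neighbour of \<open>a\<close>.\<close>

lemma inner_5_cycle_from_chord:
  assumes v: "min_degree v" and sub: "{a, b, c, d} \<subseteq> N v" and dist: "distinct [a, b, c, d]"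
    and arcs: "E a b" "E b c" "E c d" "E d a" "E d b"
  shows "\<exists>ds. simple_cycle E ds \<and> set ds \<subseteq> N v \<and> length ds = 5"
proof (rule ccontr)
  assume contr: "\<not> ?thesis"
  have in_N: "a \<in> N v" "b \<in> N v" "c \<in> N v" "d \<in> N v"
    using sub by auto
  have full: "w \<in> set xs"
    if "simple_path E xs" "set xs \<subseteq> N v" "length xs = 5" "E (last xs) w" "w \<in> N v" for xs w
    using full_path_succs[OF that(1,2) _ that(4,5)] that(3) by (simp add: k_eq)
  obtain u where u: "u \<in> N v" "E b u" "u \<noteq> c"
    using two_inner_succs[OF v in_N(2)] by blast
  have u_neq: "u \<noteq> a" "u \<noteq> b" "u \<noteq> d"
    using u(2) arcs no_loop no_2_cycle by metis+
  have u_succ: "w \<in> {a, d}" if w: "w \<in> N v" "E u w" for w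
  proof -
    have "w \<in> set [c, d, a, b, u]"
      using full[of "[c, d, a, b, u]" w] arcs dist u u_neq in_N w by (auto simp: simple_path_Cons)
    moreover have "w \<noteq> b" "w \<noteq> u"
      using u(2) w(2) no_loop no_2_cycle by metis+
    moreover have "w \<noteq> c"
    proof
      assume "w = c"
      then have "simple_cycle E [c, d, a, b, u]"
        using arcs dist u u_neq w by (auto simp: simple_cycle_def simple_path_Cons)
      then show False
        using contr in_N u(1) by fastforce
    qed
    ultimately show ?thesis by auto
  qed
  have ua: "E u a" and ud: "E u d"
    using two_inner_succs[OF v u(1)] u_succ by blast+
  obtain w where w: "w \<in> N v" "E c w" "w \<noteq> d"
    using two_inner_succs[OF v in_N(3)] by blast
  have "w \<in> set [u, d, a, b, c]"
    using full[of "[u, d, a, b, c]" w] arcs dist u u_neq in_N w ud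
    by (auto simp: simple_path_Cons)
  moreover have "w \<noteq> b" "w \<noteq> c"
    using arcs w(2) no_loop no_2_cycle by metis+
  moreover have "w \<noteq> u"
  proof
    assume "w = u"
    then have "simple_cycle E [b, c, u, d, a]"
      using arcs dist u u_neq w ud by (auto simp: simple_cycle_def simple_path_Cons)
    then show False
      using contr in_N u(1) by fastforce
  qed
  ultimately have ca: "E c a"
    using w by auto
  obtain t where t: "t \<in> N v" "E a t" "t \<noteq> b"
    using two_inner_succs[OF v in_N(1)] by blast
  have "t \<in> set [u, d, b, c, a]"
    using full[of "[u, d, b, c, a]" t] arcs dist u u_neq in_N t ud ca
    by (auto simp: simple_path_Cons)
  then show False
    using t(2,3) ua ca arcs(4) no_loop by (auto dest: no_2_cycle)
qed

text \<open>The end of a maximal path has two arcs back, so the path has 4 or 5 vertices. Either it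
  closes to a 5-cycle or its last four vertices form a 4-cycle with a chord.\<close>

lemma inner_5_cycle:
  assumes v: "min_degree v"
  shows "\<exists>ds. simple_cycle E ds \<and> set ds \<subseteq> N v \<and> length ds = 5"
proof -
  have "N v \<noteq> {}"
    using card_S[OF min_degree_V[OF v]] by (metis card.empty not_less_zero)
  then obtain x zs where p: "simple_path E (x # zs)" "set (x # zs) \<subseteq> N v"
    "{u \<in> N v. E (last (x # zs)) u} \<subseteq> set (x # zs)"
    using maximal_path_from[of "N v" _ E] by (metis ex_in_conv finite_N)
  define xs where "xs = x # zs"
  note p = p[folded xs_def]
  have len: "length xs < 6"
    using maximal_path_length[OF v p] by (simp add: k_eq)
  have end_N: "last xs \<in> N v"
    by (rule simple_path_last[OF p(1,2)])
  have next_succ: "\<exists>i. i + 3 \<le> length xs \<and> E (last xs) (xs ! i) \<and> i \<noteq> a" for a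
  proof -
    obtain u where u: "u \<in> N v" "E (last xs) u" "u \<noteq> xs ! a"
      using two_inner_succs[OF v end_N] by blast
    then show ?thesis
      using path_end_succs[OF p(1,3)] by (auto simp: g_eq)
  qed
  obtain i where i: "i + 3 \<le> length xs" "E (last xs) (xs ! i)" "i \<noteq> 0"
    using next_succ by blast
  obtain j where j: "j + 3 \<le> length xs" "E (last xs) (xs ! j)" "j \<noteq> 1"
    using next_succ by blast
  obtain l where l: "l + 3 \<le> length xs" "E (last xs) (xs ! l)" "l \<noteq> 2"
    using next_succ by blast
  consider "length xs = 4" | "length xs = 5"
    using len i by linarith
  then show ?thesis
  proof cases
    case 1
    then obtain a b c d where xs: "xs = [a, b, c, d]"
      by (auto simp: numeral_eq_Suc length_Suc_conv)
    have "i = 1" "j = 0"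
      using 1 i(1,3) j(1,3) by linarith+
    then have "E d a" "E d b"
      using i(2) j(2) by (auto simp: xs)
    then show ?thesis
      using inner_5_cycle_from_chord[OF v, of a b c d] p(1,2)
      by (simp add: xs simple_path_Cons)
  next
    case 2
    then obtain a b c d e where xs: "xs = [a, b, c, d, e]"
      by (auto simp: numeral_eq_Suc length_Suc_conv)
    show ?thesis
    proof (cases "E e a")
      case True
      then have "simple_cycle E xs"
        using p(1) by (simp add: simple_cycle_def xs)
      then show ?thesis
        using p(2) 2 by blast
    next
      case False
      then have "j \<noteq> 0" "l \<noteq> 0"
        using j(2) l(2) by (auto simp: xs intro!: gr0I)
      then have "j = 2" "l = 1"
        using 2 j(1,3) l(1,3) by linarith+
      then have "E e b" "E e c"
        using l(2) j(2) by (auto simp: xs)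
      then show ?thesis
        using inner_5_cycle_from_chord[OF v, of b c d e] p(1,2)
        by (simp add: xs simple_path_Cons)
    qed
  qed
qed

lemma inner_regular_tournament:
  assumes v: "min_degree v"
  obtains a b c d e where "distinct [a, b, c, d, e]" "{a, b, c, d, e} \<subseteq> N v"
    "N a \<inter> N v = {b, c}" "N b \<inter> N v = {c, d}" "N c \<inter> N v = {d, e}" "N d \<inter> N v = {e, a}"
    "N e \<inter> N v = {a, b}"
proof -
  obtain ds where ds: "simple_cycle E ds" "set ds \<subseteq> N v" "length ds = 5"
    using inner_5_cycle[OF v] by blast
  then obtain a b c d e where abcde: "ds = [a, b, c, d, e]"
    by (auto simp: numeral_eq_Suc length_Suc_conv)
  have dist: "distinct [a, b, c, d, e]"
    using ds(1) by (simp add: abcde simple_cycle_def simple_path_def)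
  have arcs: "E a b" "E b c" "E c d" "E d e" "E e a"
    using ds(1) by (auto simp: abcde simple_cycle_def simple_path_Cons)
  have closed: "u \<in> set ds" if "x \<in> set ds" "E x u" "u \<in> N v" for x u
    using full_cycle_succs[OF ds(1,2) _ that] ds(3) by (simp add: k_eq)
  \<comment> \<open>Here \<open>n\<close> and \<open>m\<close> are the next and the previous vertex
    of \<open>x\<close> on the 5-cycle, and \<open>p\<close>, \<open>q\<close> are the other
    two.\<close>
  have out: "E x p \<or> E x q"
    if "set ds = {x, n, p, q, m}" "E x n" "E m x" for x n p q m
  proof -
    have x: "x \<in> set ds"
      using that(1) by simp
    then have x_N: "x \<in> N v"
      using ds(2) by (rule subsetD[rotated])
    obtain u where u: "u \<in> N v" "E x u" "u \<noteq> n"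
      using two_inner_succs[OF v x_N] by blast
    have "u \<in> {x, n, p, q, m}"
      using closed[OF x u(2,1)] that(1) by simp
    moreover have "u \<noteq> x" "u \<noteq> m"
      using u(2) that(3) no_loop no_2_cycle by metis+
    ultimately show ?thesis
      using u(2,3) by auto
  qed
  have succs: "N x \<inter> N v = {n, p}"
    if "set ds = {x, n, p, q, m}" "E x n" "E x p" "E q x" "E m x" for x n p q m
  proof -
    have "u \<in> {n, p}" if u: "u \<in> N v" "E x u" for u
    proof -
      have "u \<in> {x, n, p, q, m}"
        using closed[OF _ u(2,1)] \<open>set ds = {x, n, p, q, m}\<close> by simp
      moreover have "u \<noteq> x" "u \<noteq> q" "u \<noteq> m"
        using u(2) \<open>E q x\<close> \<open>E m x\<close> no_loop no_2_cycle by metis+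
      ultimately show ?thesis by simp
    qed
    moreover have "n \<in> N v" "p \<in> N v"
      using ds(2) unfolding that(1) by simp_all
    ultimately show ?thesis
      using that(2,3) by auto
  qed
  note conclusion = that
  have conclude: thesis
    if set_ds: "set ds = {a, b, c, d, e}" and dist: "distinct [a, b, c, d, e]"
      and arcs: "E a b" "E b c" "E c d" "E d e" "E e a" "E a c" "E b d" "E c e" "E d a" "E e b"
    for a b c d e
  proof (rule conclusion[OF dist])
    show "{a, b, c, d, e} \<subseteq> N v"
      using ds(2) set_ds by simp
    show "N a \<inter> N v = {b, c}"
      by (rule succs[of a b c d e]) (use set_ds arcs in auto)
    show "N b \<inter> N v = {c, d}"
      by (rule succs[of b c d e a]) (use set_ds arcs in auto)
    show "N c \<inter> N v = {d, e}"
      by (rule succs[of c d e a b]) (use set_ds arcs in auto)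
    show "N d \<inter> N v = {e, a}"
      by (rule succs[of d e a b c]) (use set_ds arcs in auto)
    show "N e \<inter> N v = {a, b}"
      by (rule succs[of e a b c d]) (use set_ds arcs in auto)
  qed
  have "E a c \<or> E a d" by (rule out[of _ b _ _ e]) (use arcs abcde in auto)
  moreover have "E b d \<or> E b e" by (rule out[of _ c _ _ a]) (use arcs abcde in auto)
  moreover have "E c e \<or> E c a" by (rule out[of _ d _ _ b]) (use arcs abcde in auto)
  moreover have "E d a \<or> E d b" by (rule out[of _ e _ _ c]) (use arcs abcde in auto)
  moreover have "E e b \<or> E e c" by (rule out[of _ a _ _ d]) (use arcs abcde in auto)
  \<comment> \<open>Choosing one diagonal excludes its reverse, which fixes the choice at its other
    end; so all five choices turn the same way. In the second case the cycle
    \<open>a, d, b, e, c\<close> takes the role of the first.\<close>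
  ultimately consider "E a c" "E b d" "E c e" "E d a" "E e b"
    | "E a d" "E b e" "E c a" "E d b" "E e c"
    using no_2_cycle[of a c] no_2_cycle[of a d] no_2_cycle[of b d] no_2_cycle[of b e]
      no_2_cycle[of c e] by blast
  then show thesis
  proof cases
    case 1
    show thesis
      by (rule conclude[of a b c d e]) (use 1 arcs dist abcde in auto)
  next
    case 2
    show thesis
      by (rule conclude[of a d b e c]) (use 2 arcs dist abcde in auto)
  qed
qed

text \<open>A vertex \<open>w\<close> of \<open>N a - N v\<close> dominated by \<open>b\<close> and
  \<open>c\<close> sends no arc into \<open>N a\<close>, so \<open>N w \<subseteq> S a\<close>. By
  minimality of the degree of \<open>v\<close>, this makes \<open>S a\<close> too large.\<close>

lemma False_if_no_seymour: False
proof -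
  obtain v where v: "min_degree v"
    using min_degree_exists by blast
  obtain a b c d e where dist: "distinct [a, b, c, d, e]" and sub: "{a, b, c, d, e} \<subseteq> N v"
    and t: "N a \<inter> N v = {b, c}" "N b \<inter> N v = {c, d}" "N c \<inter> N v = {d, e}"
      "N d \<inter> N v = {e, a}" "N e \<inter> N v = {a, b}"
    using inner_regular_tournament[OF v] by metis
  have in_N: "a \<in> N v" "b \<in> N v" "c \<in> N v" "d \<in> N v" "e \<in> N v"
    using sub by auto
  have arcs: "E a b" "E a c" "E b c" "E b d" "E c d" "E d e" "E e b" "E d a"
    using t by blast+
  define W where "W = N a - N v"
  have W_S: "W \<subseteq> S v"
    using in_N(1) by (auto simp: W_def S_def)
  have SN: "S v \<inter> N v = {}"
    by (auto simp: S_def)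
  have Na: "N a = {b, c} \<union> W"
    using t(1) by (auto simp: W_def)
  have "card (N a) = card {b, c} + card W"
    unfolding Na using t(1) by (intro card_Un_disjoint) (auto simp: W_def)
  then have card_Na: "card (N a) = 2 + card W"
    using dist by simp
  have deg: "card (N v) \<le> card (N x)" if "E y x" for x y
    using v arc_in_V[OF that] by (simp add: min_degree_def)
  have "card {a, b, c, d, e} \<le> card (N v)"
    using sub by (intro card_mono) auto
  then have card_Nv: "5 \<le> card (N v)"
    using dist by simp
  have card_Na_le: "card (N a) \<le> Suc (card (N v))"
    using second_missed(2)[OF v in_N(1)] t(1) dist by simp
  have card_Na_ge: "card (N v) \<le> card (N a)"
    using deg in_N(1) by auto
  have "e \<noteq> a"
    using dist by auto
  then have missed: "card (S v - N b) \<le> 1" "card (S v - N c) \<le> 1" "card (S v - N d) \<le> 1"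
    using second_missed(1)[OF v in_N(2)] second_missed(1)[OF v in_N(3)]
      second_missed(1)[OF v in_N(4)] t dist by simp_all
  \<comment> \<open>The vertices of \<open>S v\<close> missed by \<open>b\<close> or
    \<open>c\<close>, at most one each. If \<open>a\<close> has one out-neighbour more than
    \<open>v\<close>, the count below also needs \<open>w\<close> to be dominated by
    \<open>d\<close>; then \<open>W\<close> is larger by one as well.\<close>
  define M where "M = (S v - N b) \<union> (S v - N c) \<union> (if card (N a) = card (N v) then {} else S v - N d)"
  have "card M < card W"
  proof (cases "card (N a) = card (N v)")
    case True
    then show ?thesis
      using missed card_Na card_Nv card_Un_le[of "S v - N b" "S v - N c"] by (simp add: M_def)
  next
    case False
    have "card M \<le> card (S v - N b) + card (S v - N c) + card (S v - N d)"
      using False card_Un_le[of "S v - N b" "S v - N c"]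
        card_Un_le[of "(S v - N b) \<union> (S v - N c)" "S v - N d"] by (simp add: M_def)
    then show ?thesis
      using missed card_Na card_Nv card_Na_ge False by linarith
  qed
  then have "\<not> W \<subseteq> M"
    using card_mono[of M W] by (auto simp: M_def)
  then obtain w where w: "w \<in> W" "w \<notin> M"
    by auto
  have bw: "E b w" and cw: "E c w"
    using w W_S by (auto simp: M_def)
  have disj: "\<not> E a z" if "E w z" for z
  proof
    assume "E a z"
    then have "z \<in> {b, c} \<union> W"
      using Na by auto
    then have "z \<in> W"
      using that no_2_cycle[OF bw] no_2_cycle[OF cw] by auto
    \<comment> \<open>Running through the tournament from \<open>a\<close> to \<open>b\<close>
      before \<open>w\<close> and \<open>z\<close> gives 7 vertices, with \<open>a\<close>
      dominating \<open>z\<close>.\<close>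
    have wz: "w \<in> S v" "z \<in> S v" "w \<noteq> z"
      using w \<open>z \<in> W\<close> W_S that no_loop by auto
    then have "simple_path E [a, c, d, e, b, w, z]"
      using dist arcs bw that in_N SN by (auto simp: simple_path_Cons)
    then show False
      using no_shortcut[of "[a, c, d, e, b, w, z]"] \<open>E a z\<close> by (simp add: k_eq)
  qed
  have aw: "E a w"
    using w by (auto simp: W_def)
  have Nw: "N w \<subseteq> S a"
    using disj aw by (auto simp: S_def)
  have card_Sa: "card (S a) < card (N a)"
    using card_S arc_in_V[OF aw] by blast
  show False
  proof (cases "card (N a) = card (N v)")
    case True
    then show False
      using card_mono[OF _ Nw] card_Sa deg[OF aw] by simp
  next
    case False
    then have "E d w"
      using w W_S by (auto simp: M_def)
    \<comment> \<open>The vertex \<open>d\<close> is the missing element: it lies in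
      \<open>S a\<close> but outside \<open>N w\<close>.\<close>
    then have "d \<notin> N w"
      by (simp add: no_2_cycle)
    moreover have "d \<in> S a"
      using arcs no_2_cycle[OF arcs(8)] by (auto simp: S_def)
    ultimately have "Suc (card (N w)) \<le> card (S a)"
      using Nw card_mono[of "S a" "insert d (N w)"] by simp
    then show False
      using card_Sa card_Na_le deg[OF aw] by linarith
  qed
qed

end

section \<open>Oriented graphs\<close>

context pair_wf_digraph
begin

section \<open>Relational powers and vertex lists as walks, cycles and paths\<close>

lemma awalk_if_relpowp:
  "((\<lambda>x y. (x, y) \<in> parcs G) ^^ n) u v \<Longrightarrow> u \<in> pverts G \<Longrightarrow> \<exists>p. awalk u p v \<and> length p = n"
proof (induction n arbitrary: u)
  case 0
  then show ?case
    by (auto simp: awalk_Nil_iff)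
next
  case (Suc n)
  then obtain w where w: "(u, w) \<in> parcs G" "((\<lambda>x y. (x, y) \<in> parcs G) ^^ n) w v"
    by (meson relpowp_Suc_E2)
  with Suc.IH obtain p where "awalk w p v" "length p = n"
    using in_arcsD2 by blast
  then show ?case
    using w(1) by (intro exI[of _ "(u, w) # p"]) (simp add: awalk_Cons_iff)
qed

text \<open>This carries cycle-freeness over to closed walks: a repeated vertex yields a shorter
  closed subwalk.\<close>

lemma cycle_in_closed_walk:
  assumes "awalk u p u" "p \<noteq> []"
  shows "\<exists>c. cycle c \<and> length c \<le> length p"
  using assms
proof (induction "length p" arbitrary: u p rule: less_induct)
  case less
  obtain e es where p: "p = e # es"
    using less.prems(2) by (cases p) auto
  show ?case
  proof (cases "distinct (pawalk_verts (snd e) es)")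
    case True
    then have "cycle p"
      using less.prems by (auto simp: cycle_def p)
    then show ?thesis by blast
  next
    case False
    moreover have "awalk (snd e) es u"
      using less.prems(1) by (auto simp: p awalk_Cons_iff)
    ultimately obtain q r s w where r: "es = q @ r @ s" "0 < length r" "awalk w r w"
      using awalk_not_distinct_decomp[of "snd e" es u] by blast
    then obtain c where "cycle c" "length c \<le> length r"
      using less.hyps[of r w] by (auto simp: p)
    then show ?thesis
      using r(1) by (intro exI[of _ c]) (auto simp: p)
  qed
qed

text \<open>Zipping the list with its tail pairs consecutive vertices. The second conjunct lets the
  induction see that \<open>u\<close> is new.\<close>

lemma apath_if_simple_path:
  assumes "simple_path (\<lambda>x y. (x, y) \<in> parcs G) (u # xs)" "u \<in> pverts G"
  shows "apath u (zip (u # xs) xs) (last (u # xs)) \<and> pawalk_verts u (zip (u # xs) xs) = u # xs"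
  using assms
proof (induction xs arbitrary: u)
  case Nil
  then show ?case
    by (simp add: apath_Nil_iff)
next
  case (Cons x xs)
  then have arc: "(u, x) \<in> parcs G" and "simple_path (\<lambda>x y. (x, y) \<in> parcs G) (x # xs)"
    by (auto simp: simple_path_Cons[of _ u])
  then have "apath x (zip (x # xs) xs) (last (x # xs)) \<and> pawalk_verts x (zip (x # xs) xs) = x # xs"
    using Cons.IH in_arcsD2 by blast
  moreover have "u \<notin> set (x # xs)"
    using Cons.prems(1) by (simp add: simple_path_def)
  ultimately show ?case
    using arc by (simp add: apath_Cons_iff)
qed

section \<open>Distances one and two in terms of arcs\<close>

lemma vdist_less_iff: "vdist v u < enat n \<longleftrightarrow> (\<exists>p. apath v p u \<and> length p < n)"
  by (auto simp: vdist_def INF_less_iff)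

lemma apath_length_1_iff:
  "(\<exists>p. apath v p u \<and> length p = 1) \<longleftrightarrow> (v, u) \<in> parcs G \<and> v \<noteq> u"
proof
  assume "\<exists>p. apath v p u \<and> length p = 1"
  then show "(v, u) \<in> parcs G \<and> v \<noteq> u"
    by (auto simp: length_Suc_conv apath_simps)
next
  assume "(v, u) \<in> parcs G \<and> v \<noteq> u"
  then show "\<exists>p. apath v p u \<and> length p = 1"
    by (intro exI[of _ "[(v, u)]"]) (simp add: apath_simps in_arcsD2[of v u])
qed

lemma apath_length_2_iff:
  "(\<exists>p. apath v p u \<and> length p = 2) \<longleftrightarrow>
    (\<exists>w. (v, w) \<in> parcs G \<and> (w, u) \<in> parcs G \<and> v \<noteq> w \<and> w \<noteq> u \<and> v \<noteq> u)"
proof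
  assume "\<exists>p. apath v p u \<and> length p = 2"
  then show "\<exists>w. (v, w) \<in> parcs G \<and> (w, u) \<in> parcs G \<and> v \<noteq> w \<and> w \<noteq> u \<and> v \<noteq> u"
    by (auto simp: numeral_2_eq_2 length_Suc_conv apath_simps)
next
  assume "\<exists>w. (v, w) \<in> parcs G \<and> (w, u) \<in> parcs G \<and> v \<noteq> w \<and> w \<noteq> u \<and> v \<noteq> u"
  then obtain w where "(v, w) \<in> parcs G" "(w, u) \<in> parcs G" "v \<noteq> w" "w \<noteq> u" "v \<noteq> u"
    by blast
  then show "\<exists>p. apath v p u \<and> length p = 2"
    by (intro exI[of _ "[(v, w), (w, u)]"]) (simp add: apath_simps in_arcsD2[of w u])
qed

lemma vdist_less_1_iff: "v \<in> pverts G \<Longrightarrow> vdist v u < enat 1 \<longleftrightarrow> v = u"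
  by (auto simp: vdist_less_iff apath_Nil_iff)

lemma vdist_less_2_iff:
  assumes v: "v \<in> pverts G"
  shows "vdist v u < enat 2 \<longleftrightarrow> v = u \<or> (v, u) \<in> parcs G"
proof -
  have "length p < 2 \<longleftrightarrow> length p < 1 \<or> length p = 1" for p :: "('a \<times> 'a) list"
    by linarith
  then have "vdist v u < enat 2 \<longleftrightarrow> vdist v u < enat 1 \<or> (\<exists>p. apath v p u \<and> length p = 1)"
    unfolding vdist_less_iff by blast
  then show ?thesis
    unfolding vdist_less_1_iff[OF v] apath_length_1_iff by blast
qed

lemma vdist_less_3_iff:
  assumes "v \<in> pverts G"
  shows "vdist v u < enat 3 \<longleftrightarrow> v = u \<or> (v, u) \<in> parcs G \<or>
    (\<exists>w. (v, w) \<in> parcs G \<and> (w, u) \<in> parcs G \<and> v \<noteq> w \<and> w \<noteq> u)"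
proof -
  have "length p < 3 \<longleftrightarrow> length p < 2 \<or> length p = 2" for p :: "('a \<times> 'a) list"
    by linarith
  then have "vdist v u < enat 3 \<longleftrightarrow> vdist v u < enat 2 \<or> (\<exists>p. apath v p u \<and> length p = 2)"
    unfolding vdist_less_iff by blast
  then show ?thesis
    unfolding vdist_less_2_iff[OF assms] apath_length_2_iff by blast
qed

end

text \<open>Strict bounds on an infimum only ask for the existence of a short path, so an exact
  distance is split into two of them.\<close>

lemma enat_eq_iff_less: "x = enat n \<longleftrightarrow> \<not> x < enat n \<and> x < enat (Suc n)"
  by (cases x) auto

lemma (in oriented_graph) out_nbrs_eq:
  assumes "v \<in> pverts D"
  shows "out_nbrs v = {u. (v, u) \<in> parcs D}"
proof -
  have "vdist v u = 1 \<longleftrightarrow> \<not> vdist v u < enat 1 \<and> vdist v u < enat 2" for u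
    using enat_eq_iff_less[of "vdist v u" 1] unfolding one_enat_def Suc_1 .
  then have "vdist v u = 1 \<longleftrightarrow> v \<noteq> u \<and> (v, u) \<in> parcs D" for u
    unfolding vdist_less_1_iff[OF assms] vdist_less_2_iff[OF assms] by blast
  then show ?thesis
    unfolding out_nbrs_def by (intro Collect_cong) (metis in_arcsD2 no_loops')
qed

text \<open>The absence of loops and opposite arcs makes \<open>v\<close>, \<open>u\<close> and
  \<open>w\<close> distinct.\<close>

lemma (in oriented_graph) second_out_nbrs_eq:
  assumes "v \<in> pverts D"
  shows "second_out_nbrs v = {w. (v, w) \<notin> parcs D \<and> (\<exists>u. (v, u) \<in> parcs D \<and> (u, w) \<in> parcs D)}"
proof -
  have "vdist v w = 2 \<longleftrightarrow> \<not> vdist v w < enat 2 \<and> vdist v w < enat 3" for w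
    using enat_eq_iff_less[of "vdist v w" 2] numeral_eq_enat[of "num.Bit0 num.One"]
    by (metis eval_nat_numeral(3))
  then have "vdist v w = 2 \<longleftrightarrow> v \<noteq> w \<and> (v, w) \<notin> parcs D \<and>
    (\<exists>u. (v, u) \<in> parcs D \<and> (u, w) \<in> parcs D \<and> v \<noteq> u \<and> u \<noteq> w)" for w
    unfolding vdist_less_2_iff[OF assms] vdist_less_3_iff[OF assms] by blast
  then show ?thesis
    unfolding second_out_nbrs_def
    by (intro Collect_cong) (metis in_arcsD2 no_loops' no_opposite_arcs)
qed

theorem theorem3p1:
  fixes D :: "'a pair_pre_digraph" and k :: nat
  assumes "oriented_graph D"
    and "k > 0"
    and "pair_pre_digraph.anti_transitive D k"
    and "pair_pre_digraph.cycle_free_upto D (int k - 4)"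
  shows "\<exists>v \<in> pverts D. pair_pre_digraph.seymour_vertex D v"
proof (rule ccontr)
  assume contr: "\<not> (\<exists>v \<in> pverts D. pair_pre_digraph.seymour_vertex D v)"
  interpret oriented_graph D
    by (rule assms(1))
  define E where "E = (\<lambda>x y. (x, y) \<in> parcs D)"
  \<comment> \<open>An oriented graph has no cycle of length 1 or 2, and
    \<open>(k - 4)\<close>-freeness gives length at least \<open>k - 3\<close>; for small
    \<open>k\<close> the maximum absorbs the truncated subtraction.\<close>
  have "no_seymour (pverts D) E (max 3 (k - 3)) k"
  proof
    show "finite (pverts D)"
      by (rule pair_finite_verts)
    show "pverts D \<noteq> {}"
      by (rule verts_nonempty)
    show "u \<in> pverts D \<and> v \<in> pverts D" if "E u v" for u v
      using that in_arcsD1 in_arcsD2 unfolding E_def by blast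
    show "max 3 (k - 3) \<le> n" if n: "(E ^^ n) u u" "0 < n" for n u
    proof -
      have "n \<noteq> 1"
        using n(1) no_loops'[of u u] by (auto simp: E_def)
      moreover have "n \<noteq> 2"
        using n(1) no_opposite_arcs by (auto simp: E_def numeral_2_eq_2)
      moreover have "k - 3 \<le> n"
      proof -
        obtain w where "E u w"
          using n by (metis gr0_conv_Suc relpowp_Suc_D2)
        then have "u \<in> pverts D"
          using in_arcsD1 by (simp add: E_def)
        then obtain p where "awalk u p u" "length p = n"
          using awalk_if_relpowp n(1) unfolding E_def by blast
        then obtain c where "cycle c" "length c \<le> n"
          using cycle_in_closed_walk[of u p] n(2) by auto
        then show ?thesis
          using assms(4) unfolding cycle_free_upto_def by force
      qed
      ultimately show ?thesis
        using n(2) by simp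
    qed
    show "\<not> E (hd xs) (last xs)" if xs: "simple_path E xs" "length xs = Suc k" for xs
    proof
      assume arc: "E (hd xs) (last xs)"
      obtain u ys where u: "xs = u # ys"
        using xs(2) by (cases xs) auto
      have V: "u \<in> pverts D" "last xs \<in> pverts D"
        using arc in_arcsD1 in_arcsD2 unfolding E_def u by auto
      have "apath u (zip xs ys) (last xs)"
        using apath_if_simple_path[of u ys] xs(1) V(1) unfolding E_def u by blast
      moreover have "length (zip xs ys) = k"
        using xs(2) by (simp add: u)
      ultimately have "(u, last xs) \<notin> parcs D"
        using assms(3) V unfolding anti_transitive_def by blast
      then show False
        using arc by (simp add: E_def u)
    qed
    show "card {w. \<not> E v w \<and> (\<exists>u. E v u \<and> E u w)} < card {u. E v u}" if "v \<in> pverts D" for v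
      using contr that out_nbrs_eq[OF that] second_out_nbrs_eq[OF that]
      by (auto simp: seymour_vertex_def E_def)
  qed (use assms(2) in auto)
  then show False
    by (rule no_seymour.False_if_no_seymour)
qed

end
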